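(* Let $(x_n)_{n\ge 1}$ be a nonincreasing sequence of positive real numbers such that $\sum_{n} x_n = +\infty$, $\lim_{n\to\infty} x_n = 0$, and $$L := \liminf_{n\to\infty} \frac{x_{n+1}}{x_n} > \frac{\sqrt5-1}{2} .$$ Then, for each real $\ell>0$ and each real $\varepsilon>0$, there exists a subsequence $(x_{n_k})_{k\ge 1}$ for which $\sum_{k} x_{n_k}=\ell$ and $$x_{n_k} = O\left(\left(\sqrt{1+\varepsilon-L}\right)^{k}\right).$$
   Context: A subsequence $(x_{n_k})_{k\ge1}$ is given by a strictly increasing infinite sequence of indices $n_1<n_2<\cdots$. For a real sequence $(a_k)$ and a function $f:\mathbf{N}\to(0,\infty)$, the notation $a_k=O(f(k))$ means $\limsup_{k\to\infty} a_k/f(k)<\infty$. Since $(x_n)$ is nonincreasing, $L\le 1$, so $1+\varepsilon-L>0$. *)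

theory Defs
  imports "HOL-Analysis.Analysis"
begin

end

theory Submission
  imports Defs
begin

text \<open>
  The subsequence is chosen greedily: when \<open>r > 0\<close> is what remains of the prescribed sum and
  \<open>m\<close> is the index used last, the next index is the first \<open>n > m\<close> with \<open>x n < r\<close>. The strict
  inequality keeps every remainder positive, so that infinitely many terms are used.

  The process has two phases. While \<open>x m < r\<close>, monotonicity makes it take consecutive terms; since
  the series diverges, this cannot go on forever, so that \<open>r \<le> x m\<close> at some stage. From then on
  the chosen index \<open>n\<close> satisfies \<open>x n < r \<le> x (n - 1)\<close>. If consecutive ratios are at least
  \<open>1 - s\<close>, then \<open>x n \<ge> (1 - s) * r\<close>, so the new remainder is at most \<open>s * r\<close>. For \<open>s \<le> 1/2\<close> it
  is also at most \<open>(1 - s) * r \<le> x n\<close>, and the second phase perpetuates itself. Thus remainders, and with them the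
  chosen terms, decay like \<open>s ^ k\<close>.

  In the theorem \<open>s\<close> may be any number with \<open>1 - L < s < 1/2\<close>. Choosing also \<open>s \<le> 1 + \<epsilon> - L\<close>, the
  rate \<open>s ^ k\<close> is at least as good as the required one because \<open>s \<le> sqrt s\<close> on the unit interval.
\<close>

locale greedy_selection =
  fixes x :: "nat \<Rightarrow> real" and l :: real and N :: nat
  assumes decreasing: "\<And>n. n \<ge> N \<Longrightarrow> x (Suc n) \<le> x n"
    and null: "x \<longlonglongrightarrow> 0"
    and target_pos: "l > 0"
begin

definition next_index :: "nat \<Rightarrow> real \<Rightarrow> nat" where
  "next_index m r = (LEAST n. n > m \<and> x n < r)"

text \<open>A state is the index used last together with the remaining part of the sum.
  The initial index \<open>N\<close> is not itself counted as used.\<close>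

primrec state :: "nat \<Rightarrow> nat \<times> real" where
  "state 0 = (N, l)"
| "state (Suc k) = (let (m, r) = state k; n = next_index m r in (n, r - x n))"

definition index :: "nat \<Rightarrow> nat" where "index k = fst (state k)"
definition rest :: "nat \<Rightarrow> real" where "rest k = snd (state k)"

lemma index_0: "index 0 = N"
  and rest_0: "rest 0 = l"
  and index_Suc: "index (Suc k) = next_index (index k) (rest k)"
  and rest_Suc: "rest (Suc k) = rest k - x (index (Suc k))"
  by (simp_all add: index_def rest_def Let_def split: prod.splits)

lemma next_index:
  assumes "r > 0"
  shows next_index_greater: "m < next_index m r"
    and next_index_below: "x (next_index m r) < r"
proof -
  have "\<forall>\<^sub>F n in sequentially. x n < r"
    using order_tendstoD(2)[OF null assms] .
  then have "\<forall>\<^sub>F n in sequentially. n > m \<and> x n < r"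
    using eventually_gt_at_top[of m] by eventually_elim simp
  then obtain n where "n > m \<and> x n < r"
    by (auto simp: eventually_sequentially)
  then have "next_index m r > m \<and> x (next_index m r) < r"
    unfolding next_index_def by (rule LeastI)
  then show "m < next_index m r" and "x (next_index m r) < r"
    by simp_all
qed

lemma next_index_minimal: "\<lbrakk>m < j; j < next_index m r\<rbrakk> \<Longrightarrow> r \<le> x j"
  unfolding next_index_def using not_less_Least by fastforce

lemma rest_pos: "rest k > 0"
  by (induction k) (auto simp: rest_0 rest_Suc index_Suc target_pos dest: next_index_below)

lemma index_less_index_Suc: "index k < index (Suc k)"
  using next_index_greater[OF rest_pos] by (simp add: index_Suc)

lemma term_below_rest: "x (index (Suc k)) < rest k"
  using next_index_below[OF rest_pos] by (simp add: index_Suc)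

lemma strict_mono_index: "strict_mono index"
  by (simp add: strict_mono_Suc_iff index_less_index_Suc)

lemma index_ge: "index k \<ge> N"
  using strict_mono_less_eq[OF strict_mono_index, of 0 k] by (simp add: index_0)

lemma rest_eq: "rest k = l - (\<Sum>i<k. x (index (Suc i)))"
  by (induction k) (simp_all add: rest_0 rest_Suc)

text \<open>If the remainder always exceeded the last term, the choice would run through all indices
  after \<open>N\<close>, and a divergent series would have bounded partial sums.\<close>

lemma rest_eventually_le_term:
  assumes diverges: "filterlim (\<lambda>k. \<Sum>i<k. x (N + Suc i)) at_top sequentially"
  shows "\<exists>K. rest K \<le> x (index K)"
proof (rule ccontr)
  assume "\<nexists>K. rest K \<le> x (index K)"
  then have above: "x (index k) < rest k" for k
    by (meson not_le)
  have consecutive: "index k = N + k" for k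
  proof (induction k)
    case 0
    then show ?case by (simp add: index_0)
  next
    case (Suc k)
    have "x (Suc (index k)) < rest k"
      using above[of k] decreasing[OF index_ge] by (meson le_less_trans)
    then have "\<not> Suc (index k) < index (Suc k)"
      using next_index_minimal[of "index k" "Suc (index k)" "rest k"] by (auto simp: index_Suc)
    then show ?case
      using index_less_index_Suc[of k] Suc by simp
  qed
  have "\<forall>\<^sub>F k in sequentially. l \<le> (\<Sum>i<k. x (N + Suc i))"
    using diverges by (simp add: filterlim_at_top)
  then obtain k where "l \<le> (\<Sum>i<k. x (N + Suc i))"
    by (auto simp: eventually_sequentially)
  moreover have "(\<Sum>i<k. x (N + Suc i)) < l"
    using rest_pos[of k] unfolding rest_eq consecutive by simp
  ultimately show False by simp
qed

text \<open>In the second phase the term just before the chosen one is at least the remainder, so the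
  chosen term is at least the fraction \<open>1 - s\<close> of the remainder. What is left is at most the
  fraction \<open>s \<le> 1 - s\<close>, hence no larger than the chosen term: this puts the next stage in the
  second phase as well.\<close>

lemma rest_contracts:
  assumes ratio: "\<And>n. n \<ge> N \<Longrightarrow> (1 - s) * x n \<le> x (Suc n)"
    and s: "s \<le> 1/2"
    and below: "rest k \<le> x (index k)"
  shows "rest (Suc k) \<le> s * rest k" and "rest (Suc k) \<le> x (index (Suc k))"
proof -
  obtain p where p: "index (Suc k) = Suc p" "index k \<le> p"
    using index_less_index_Suc[of k] by (cases "index (Suc k)") auto
  have "rest k \<le> x p"
  proof (cases "p = index k")
    case True
    then show ?thesis using below by simp
  next
    case False
    then show ?thesis
      using p by (intro next_index_minimal[of "index k"]) (auto simp flip: index_Suc)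
  qed
  then have "(1 - s) * rest k \<le> (1 - s) * x p"
    using s by (intro mult_left_mono) auto
  also have "\<dots> \<le> x (index (Suc k))"
    using ratio[of p] p index_ge[of k] by simp
  finally have large: "(1 - s) * rest k \<le> x (index (Suc k))" .
  then show contract: "rest (Suc k) \<le> s * rest k"
    by (simp add: rest_Suc algebra_simps)
  have "s * rest k \<le> (1 - s) * rest k"
    using s rest_pos[of k] by (intro mult_right_mono) auto
  then show "rest (Suc k) \<le> x (index (Suc k))"
    using contract large by linarith
qed

lemma rest_geometric_decay:
  assumes diverges: "filterlim (\<lambda>k. \<Sum>i<k. x (N + Suc i)) at_top sequentially"
    and ratio: "\<And>n. n \<ge> N \<Longrightarrow> (1 - s) * x n \<le> x (Suc n)"
    and s: "0 < s" "s \<le> 1/2"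
  shows "\<exists>C. \<forall>\<^sub>F k in sequentially. rest k \<le> C * s ^ k"
proof -
  obtain K where K: "rest K \<le> x (index K)"
    using rest_eventually_le_term[OF diverges] ..
  define C where "C = rest K / s ^ K"
  have "rest k \<le> x (index k) \<and> rest k \<le> C * s ^ k" if "k \<ge> K" for k
    using that
  proof (induction k rule: dec_induct)
    case base
    then show ?case using K s by (simp add: C_def)
  next
    case (step k)
    have "rest (Suc k) \<le> s * rest k"
      using rest_contracts(1)[OF ratio s(2)] step.IH by blast
    also have "\<dots> \<le> s * (C * s ^ k)"
      using step.IH s by (intro mult_left_mono) auto
    finally show ?case
      using rest_contracts(2)[OF ratio s(2)] step.IH by (simp add: mult_ac)
  qed
  then show ?thesis
    unfolding eventually_sequentially by blast
qed

lemma sums_target: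
  assumes "0 < s" "s < 1" "\<forall>\<^sub>F k in sequentially. rest k \<le> C * s ^ k"
  shows "(\<lambda>k. x (index (Suc k))) sums l"
proof -
  have "(\<lambda>k. C * s ^ k) \<longlonglongrightarrow> 0"
    using assms by (intro tendsto_mult_right_zero LIMSEQ_power_zero) auto
  then have "rest \<longlonglongrightarrow> 0"
    using assms(3) rest_pos
    by (intro tendsto_sandwich[of "\<lambda>_. 0" rest _ "\<lambda>k. C * s ^ k"]) (auto simp: less_imp_le)
  then have "(\<lambda>k. l - rest k) \<longlonglongrightarrow> l - 0"
    by (intro tendsto_intros)
  then show ?thesis
    by (simp add: sums_def rest_eq)
qed

end

text \<open>Each chosen term lies below the remainder before it, so the terms inherit the decay of the
  remainders.\<close>

lemma subseries_with_geometric_terms: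
  fixes x :: "nat \<Rightarrow> real"
  assumes decreasing: "\<And>n. n \<ge> N \<Longrightarrow> x (Suc n) \<le> x n"
    and null: "x \<longlonglongrightarrow> 0"
    and diverges: "filterlim (\<lambda>k. \<Sum>i<k. x (N + Suc i)) at_top sequentially"
    and ratio: "\<And>n. n \<ge> N \<Longrightarrow> (1 - s) * x n \<le> x (Suc n)"
    and s: "0 < s" "s \<le> 1/2" and l: "0 < l"
  shows "\<exists>n C. strict_mono n \<and> (\<forall>k. n k \<ge> N) \<and> (\<lambda>k. x (n (Suc k))) sums l \<and>
           (\<forall>\<^sub>F k in sequentially. x (n k) \<le> C * s ^ k)"
proof -
  interpret greedy_selection x l N
    using decreasing null l by unfold_locales
  obtain C where C: "\<forall>\<^sub>F k in sequentially. rest k \<le> C * s ^ k"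
    using rest_geometric_decay[OF diverges ratio s] by blast
  have "\<forall>\<^sub>F k in sequentially. x (index (Suc k)) \<le> C / s * s ^ Suc k"
    using C
  proof eventually_elim
    case (elim k)
    then show ?case using term_below_rest[of k] s by simp
  qed
  then have "\<forall>\<^sub>F k in sequentially. x (index k) \<le> C / s * s ^ k"
    by (rule eventually_sequentially_Suc[THEN iffD1])
  moreover have "(\<lambda>k. x (index (Suc k))) sums l"
    using sums_target[OF _ _ C] s by simp
  ultimately show ?thesis
    using strict_mono_index index_ge by blast
qed

lemma filterlim_tail_sums_at_top:
  fixes x :: "nat \<Rightarrow> real"
  assumes "filterlim (\<lambda>n. \<Sum>i=1..n. x i) at_top sequentially"
  shows "filterlim (\<lambda>k. \<Sum>i<k. x (N + Suc i)) at_top sequentially"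
proof -
  have split: "(\<Sum>i<k. x (N + Suc i)) = - (\<Sum>i=1..N. x i) + (\<Sum>i=1..k + N. x i)" for k
    by (induction k) (simp_all add: add.commute)
  have "filterlim (\<lambda>k. \<Sum>i=1..k + N. x i) at_top sequentially"
    using filterlim_compose[OF assms filterlim_add_const_nat_at_top[of N]] .
  then show ?thesis
    unfolding split by (rule filterlim_tendsto_add_at_top[OF tendsto_const])
qed

theorem corollary4:
  fixes x :: "nat \<Rightarrow> real" and L :: real
  assumes pos: "\<And>n. n \<ge> 1 \<Longrightarrow> x n > 0"
    and nonincreasing: "\<And>n. n \<ge> 1 \<Longrightarrow> x (n + 1) \<le> x n"
    and diverges: "filterlim (\<lambda>N. \<Sum>n=1..N. x n) at_top sequentially"
    and null: "x \<longlonglongrightarrow> 0"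
    and L: "ereal L = liminf (\<lambda>n. ereal (x (n + 1) / x n))"
    and golden: "L > (sqrt 5 - 1) / 2"
  shows "\<forall>l>0. \<forall>\<epsilon>>0. \<exists>n :: nat \<Rightarrow> nat.
           strict_mono_on {1..} n \<and> n ` {1..} \<subseteq> {1..} \<and>
           (\<lambda>k. x (n (Suc k))) sums l \<and>
           limsup (\<lambda>k. ereal (x (n k) / sqrt (1 + \<epsilon> - L) ^ k)) < \<infinity>"
proof (intro allI impI)
  fix l \<epsilon> :: real
  assume l: "l > 0" and \<epsilon>: "\<epsilon> > 0"
  have "sqrt 5 > 2"
    by (simp add: real_less_rsqrt)
  then have L_gt: "L > 1/2"
    using golden by simp
  have "\<forall>\<^sub>F n in sequentially. ereal (x (n + 1) / x n) \<le> ereal 1"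
    using eventually_ge_at_top[of 1]
    by eventually_elim (use pos nonincreasing in \<open>simp add: divide_le_eq_1\<close>)
  then have "limsup (\<lambda>n. ereal (x (n + 1) / x n)) \<le> ereal 1"
    by (rule Limsup_bounded)
  then have "ereal L \<le> ereal 1"
    unfolding L using Liminf_le_Limsup[OF sequentially_bot] by (rule order_trans[rotated])
  then have L_le: "L \<le> 1"
    by simp
  obtain s where s: "1 - L < s" "s < min (1 + \<epsilon> - L) (1/2)"
    using dense[of "1 - L" "min (1 + \<epsilon> - L) (1/2)"] \<epsilon> L_gt by auto
  have s_pos: "0 < s"
    using s L_le by simp
  have "ereal (1 - s) < liminf (\<lambda>n. ereal (x (n + 1) / x n))"
    using s unfolding L[symmetric] by simp
  then have "\<forall>\<^sub>F n in sequentially. 1 - s < x (n + 1) / x n"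
    by (auto dest: less_LiminfD)
  then obtain N0 where N0: "\<And>n. n \<ge> N0 \<Longrightarrow> 1 - s < x (n + 1) / x n"
    by (auto simp: eventually_sequentially)
  define N where "N = max 1 N0"
  have ratio: "(1 - s) * x n \<le> x (Suc n)" if "n \<ge> N" for n
    using N0[of n] pos[of n] that by (simp add: N_def pos_less_divide_eq)
  have decreasing: "x (Suc n) \<le> x n" if "n \<ge> N" for n
    using nonincreasing[of n] that by (simp add: N_def)
  obtain n C where n: "strict_mono n" "\<And>k. n k \<ge> N" "(\<lambda>k. x (n (Suc k))) sums l"
    and C: "\<forall>\<^sub>F k in sequentially. x (n k) \<le> C * s ^ k"
    using subseries_with_geometric_terms[of N, OF decreasing null
        filterlim_tail_sums_at_top[OF diverges] ratio s_pos _ l] s by auto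
  let ?\<rho> = "sqrt (1 + \<epsilon> - L)"
  have "s\<^sup>2 \<le> s"
    using s s_pos by (simp add: power2_eq_square mult_left_le_one_le)
  then have s_le: "s \<le> ?\<rho>"
    using s by (intro real_le_rsqrt) simp
  have "\<forall>\<^sub>F k in sequentially. ereal (x (n k) / ?\<rho> ^ k) \<le> ereal C"
    using C
  proof eventually_elim
    case (elim k)
    have "0 < x (n k)"
      using pos n(2)[of k] by (simp add: N_def)
    then have "0 < C * s ^ k"
      using elim by linarith
    then have "C > 0"
      using s_pos by (simp add: zero_less_mult_iff)
    then have "C * s ^ k \<le> C * ?\<rho> ^ k"
      using s_le s_pos by (intro mult_left_mono power_mono) auto
    then have "x (n k) \<le> C * ?\<rho> ^ k"
      using elim by linarith
    moreover have "0 < ?\<rho> ^ k"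
      using s_le s_pos by (intro zero_less_power) linarith
    ultimately show ?case
      by (simp add: pos_divide_le_eq)
  qed
  then have "limsup (\<lambda>k. ereal (x (n k) / ?\<rho> ^ k)) \<le> ereal C"
    by (rule Limsup_bounded)
  then have "limsup (\<lambda>k. ereal (x (n k) / ?\<rho> ^ k)) < \<infinity>"
    by (rule le_less_trans) simp
  moreover have "strict_mono_on {1..} n" "n ` {1..} \<subseteq> {1..}"
    using n(1,2) by (auto simp: strict_mono_on_def strict_mono_def N_def)
  ultimately show "\<exists>n :: nat \<Rightarrow> nat.
           strict_mono_on {1..} n \<and> n ` {1..} \<subseteq> {1..} \<and>
           (\<lambda>k. x (n (Suc k))) sums l \<and>
           limsup (\<lambda>k. ereal (x (n k) / sqrt (1 + \<epsilon> - L) ^ k)) < \<infinity>"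
    using n(3) by blast
qed

end
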